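(* Let $Q$ be a delta operator with umbral operator $\phi$. Then \[ \phi=Q'\,(D/Q)^{\hat xD+1}, \] and moreover $\phi=\hat x(D/Q)^{\hat xD+1}\hat x^{-1}$, in the sense that $\phi x^n=\hat x\,(D/Q)^{\hat xD+1}x^{n-1}$ for every $n\ge1$.
   Context: $\mathbb K$ is a field of characteristic zero; operators are linear maps on $\mathbb K[x]$; $\hat x$ is multiplication by $x$, $D=d/dx$. Shift-invariant operators (commuting with all shifts $f(x)\mapsto f(x+a)$) are formal power series in $D$. A delta operator is a shift-invariant $Q$ with $Qx$ a nonzero constant; $Q=DP$ with $P$ an invertible shift-invariant operator, and $D/Q\defeq P^{-1}$. Its umbral operator $\phi$ is given by $\phi x^n=\phi_n(x)$ where $(\phi_n)$ is the unique polynomial sequence with $\deg\phi_n=n$, $\phi_0=1$, $\phi_n(0)=0$ ($n\ge1$), $Q\phi_n=n\phi_{n-1}$. $Q'=Q\hat x-\hat xQ$ is the Pincherle derivative. Generalized exponentiation of operators: $U^V\defeq\sum_{m\ge0}(U-1)^m\binom{V}{m}$ with $\binom{V}{m}=V(V-1)\cdots(V-m+1)/m!$ (note the order: powers of $U-1$ on the left); applied to $x^n$, $\binom{\hat xD+1}{m}x^n=\binom{n+1}{m}x^n$, so the sum is finite. *)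

theory Defs
  imports
    "HOL-Computational_Algebra.Polynomial"
    "HOL-Library.Groups_Big_Fun"
begin

abbreviation linear_op :: "('a::field poly \<Rightarrow> 'a poly) \<Rightarrow> bool" where
  "linear_op T \<equiv> Vector_Spaces.linear smult smult T"

definition xhat :: "'a::comm_semiring_1 poly \<Rightarrow> 'a poly" where
  "xhat p = [:0, 1:] * p"

definition shift :: "'a::comm_semiring_1 \<Rightarrow> 'a poly \<Rightarrow> 'a poly" where
  "shift a p = pcompose p [:a, 1:]"

definition shift_invariant :: "('a::field poly \<Rightarrow> 'a poly) \<Rightarrow> bool" where
  "shift_invariant T \<longleftrightarrow> linear_op T \<and> (\<forall>a. T \<circ> shift a = shift a \<circ> T)"

definition delta_operator :: "('a::field poly \<Rightarrow> 'a poly) \<Rightarrow> bool" where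
  "delta_operator Q \<longleftrightarrow> shift_invariant Q \<and> (\<exists>c. c \<noteq> 0 \<and> Q [:0, 1:] = [:c:])"

text \<open>The operator \<open>D/Q\<close>: the inverse of the unique invertible shift-invariant \<open>P\<close> with \<open>Q = DP\<close>.\<close>

definition D_over :: "('a::field_char_0 poly \<Rightarrow> 'a poly) \<Rightarrow> 'a poly \<Rightarrow> 'a poly" where
  "D_over Q = inv (THE P. shift_invariant P \<and> bij P \<and> Q = pderiv \<circ> P)"

definition is_basic_sequence ::
  "('a::field_char_0 poly \<Rightarrow> 'a poly) \<Rightarrow> (nat \<Rightarrow> 'a poly) \<Rightarrow> bool" where
  "is_basic_sequence Q s \<longleftrightarrow>
     (\<forall>n. degree (s n) = n) \<and> s 0 = 1 \<and> (\<forall>n\<ge>1. poly (s n) 0 = 0) \<and>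
     (\<forall>n\<ge>1. Q (s n) = smult (of_nat n) (s (n - 1)))"

definition basic_sequence :: "('a::field_char_0 poly \<Rightarrow> 'a poly) \<Rightarrow> nat \<Rightarrow> 'a poly" where
  "basic_sequence Q = (THE s. is_basic_sequence Q s)"

text \<open>The linear map sending \<open>x\<^sup>n\<close> to the \<open>n\<close>-th member of the basic sequence.\<close>

definition umbral_operator :: "('a::field_char_0 poly \<Rightarrow> 'a poly) \<Rightarrow> 'a poly \<Rightarrow> 'a poly" where
  "umbral_operator Q p = (\<Sum>n\<le>degree p. smult (coeff p n) (basic_sequence Q n))"

definition pincherle :: "('a::comm_ring_1 poly \<Rightarrow> 'a poly) \<Rightarrow> 'a poly \<Rightarrow> 'a poly" where
  "pincherle Q p = Q (xhat p) - xhat (Q p)"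

primrec op_ffact :: "('a::comm_ring_1 poly \<Rightarrow> 'a poly) \<Rightarrow> nat \<Rightarrow> 'a poly \<Rightarrow> 'a poly" where
  "op_ffact V 0 = id"
| "op_ffact V (Suc m) = op_ffact V m \<circ> (\<lambda>p. V p - smult (of_nat m) p)"

definition op_binom :: "('a::field_char_0 poly \<Rightarrow> 'a poly) \<Rightarrow> nat \<Rightarrow> 'a poly \<Rightarrow> 'a poly" where
  "op_binom V m p = smult (1 / fact m) (op_ffact V m p)"

text \<open>The infinite sum is taken pointwise; it is meaningful when, for each \<open>p\<close>, only finitely
  many terms are nonzero (\<open>Sum_any\<close> is \<open>0\<close> otherwise). See \<open>finite_op_power_terms\<close> below.\<close>

definition op_power ::
  "('a::field_char_0 poly \<Rightarrow> 'a poly) \<Rightarrow> ('a poly \<Rightarrow> 'a poly) \<Rightarrow> 'a poly \<Rightarrow> 'a poly" where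
  "op_power U V p = Sum_any (\<lambda>m. ((\<lambda>q. U q - q) ^^ m) (op_binom V m p))"

definition xD_plus_1 :: "'a::field_char_0 poly \<Rightarrow> 'a poly" where
  "xD_plus_1 p = xhat (pderiv p) + p"

lemma coeff_xD_plus_1: "coeff (xD_plus_1 p) k = of_nat (k + 1) * coeff p k"
  by (cases k) (simp_all add: xD_plus_1_def xhat_def coeff_pderiv algebra_simps)

lemma coeff_op_ffact_xD_plus_1:
  "coeff (op_ffact xD_plus_1 m p) k = (\<Prod>i<m. of_nat (k + 1) - of_nat i) * coeff p k"
  by (induction m arbitrary: p) (simp_all add: coeff_xD_plus_1 algebra_simps)

lemma op_binom_xD_plus_1_monom:
  "op_binom xD_plus_1 m (monom 1 n) = monom (of_nat ((n + 1) choose m)) n"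
  by (rule poly_eqI)
     (auto simp: op_binom_def coeff_op_ffact_xD_plus_1 binomial_gbinomial gbinomial_prod_rev
       atLeast0LessThan)

lemma finite_op_power_terms:
  assumes "linear_op U"
  shows "finite {m. ((\<lambda>q. U q - q) ^^ m) (op_binom xD_plus_1 m p) \<noteq> 0}"
proof (rule finite_subset)
  interpret Vector_Spaces.linear smult smult U by fact
  have z: "((\<lambda>q. U q - q) ^^ m) 0 = 0" for m
    by (induction m) (simp_all add: zero)
  have "op_binom xD_plus_1 m p = 0" if "m > degree p + 1" for m
  proof (rule poly_eqI)
    fix k
    show "coeff (op_binom xD_plus_1 m p) k = coeff 0 k"
    proof (cases "k \<le> degree p")
      case True
      have "(\<Prod>i<m. of_nat (k + 1) - of_nat i :: 'a) = 0"
        using True that by (intro prod_zero bexI[of _ "k + 1"]) auto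
      then show ?thesis
        by (simp only: op_binom_def coeff_smult coeff_op_ffact_xD_plus_1) simp
    next
      case False
      then show ?thesis
        by (simp add: op_binom_def coeff_op_ffact_xD_plus_1 coeff_eq_0)
    qed
  qed
  then have "((\<lambda>q. U q - q) ^^ m) (op_binom xD_plus_1 m p) = 0" if "\<not> m \<le> degree p + 1" for m
    using that by (simp only: not_le z)
  then show "{m. ((\<lambda>q. U q - q) ^^ m) (op_binom xD_plus_1 m p) \<noteq> 0} \<subseteq> {..degree p + 1}"
    by blast
qed simp

end

theory Submission
  imports Defs "HOL-Computational_Algebra.Formal_Power_Series"
begin

text \<open>Shift-invariant operators are exactly the power series in \<open>D\<close>, and this correspondence turns
  composition into multiplication and the Pincherle derivative into the formal derivative. Writing
  \<open>Q = D p(D)\<close> and \<open>u = 1/p\<close>, the binomial theorem gives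
  \<open>(D/Q)\<^bsup>xD+1\<^esup> x\<^sup>n = u\<^bsup>n+1\<^esup>(D) x\<^sup>n\<close>. The polynomials \<open>s\<^sub>n = Q' u\<^bsup>n+1\<^esup>(D) x\<^sup>n\<close> satisfy
  \<open>Q s\<^sub>n = Q' u\<^sup>n(D) D x\<^sup>n = n s\<^bsub>n-1\<^esub>\<close>, and expanding \<open>Q' = p(D) + D p'(D)\<close> identifies
  \<open>s\<^sub>n\<close> with \<open>x u\<^sup>n(D) x\<^bsup>n-1\<^esup>\<close>, which has degree \<open>n\<close> and vanishes at \<open>0\<close>. So \<open>s\<close> is the basic
  sequence.\<close>

subsection \<open>Linear operators on polynomials\<close>

lemma smult_sum_right: "smult c (\<Sum>i\<in>A. f i) = (\<Sum>i\<in>A. smult c (f i))"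
  by (induction A rule: infinite_finite_induct) (simp_all add: smult_add_right)

lemma linear_op_iff:
  "linear_op T \<longleftrightarrow> (\<forall>p q. T (p + q) = T p + T q) \<and> (\<forall>c p. T (smult c p) = smult c (T p))"
  by (auto simp: Vector_Spaces.linear_iff vector_space_def smult_add_right smult_add_left)

lemma linear_op_sum:
  assumes "linear_op T"
  shows "T (\<Sum>i\<in>A. f i) = (\<Sum>i\<in>A. T (f i))"
proof -
  interpret Vector_Spaces.linear smult smult T by fact
  show ?thesis by (rule sum)
qed

lemma linear_op_smult:
  assumes "linear_op T"
  shows "T (smult c p) = smult c (T p)"
  using assms by (simp add: linear_op_iff)

lemma linear_op_expand:
  assumes "linear_op T"
  shows "T p = (\<Sum>n\<le>degree p. smult (coeff p n) (T (monom 1 n)))"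
proof -
  have "T p = T (\<Sum>n\<le>degree p. smult (coeff p n) (monom 1 n))"
    by (simp add: smult_monom poly_as_sum_of_monoms)
  then show ?thesis
    by (simp add: linear_op_sum[OF assms] linear_op_smult[OF assms])
qed

lemma linear_op_eqI:
  assumes "linear_op S" "linear_op T" "\<And>n. S (monom 1 n) = T (monom 1 n)"
  shows "S = T"
proof
  fix p
  show "S p = T p"
    unfolding linear_op_expand[OF assms(1), of p] linear_op_expand[OF assms(2), of p] assms(3) ..
qed

subsection \<open>Power series in the derivative\<close>

text \<open>This is the operator \<open>f(D)\<close>. Stopping at \<open>degree p\<close> loses
  nothing, since all higher derivatives of \<open>p\<close> vanish.\<close>

definition fps_op :: "'a::field_char_0 fps \<Rightarrow> 'a poly \<Rightarrow> 'a poly" where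
  "fps_op f p = (\<Sum>k\<le>degree p. smult (fps_nth f k) ((pderiv ^^ k) p))"

lemma higher_pderiv_eq_0:
  fixes p :: "'a::field_char_0 poly"
  assumes "degree p < k"
  shows "(pderiv ^^ k) p = 0"
  using assms by (intro poly_eqI) (simp add: coeff_higher_pderiv coeff_eq_0)

text \<open>A free upper bound lets sums for polynomials of different degrees share one
  range.\<close>

lemma fps_op_eq_sum:
  assumes "degree p \<le> N"
  shows "fps_op f p = (\<Sum>k\<le>N. smult (fps_nth f k) ((pderiv ^^ k) p))"
  unfolding fps_op_def using assms
  by (intro sum.mono_neutral_left) (auto simp: higher_pderiv_eq_0)

lemma linear_fps_op: "linear_op (fps_op f)"
proof -
  have "fps_op f (p + q) = fps_op f p + fps_op f q" for p q
    by (simp add: fps_op_eq_sum[where N = "max (degree p) (degree q)"] degree_add_le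
        higher_pderiv_add smult_add_right sum.distrib)
  moreover have "fps_op f (smult c p) = smult c (fps_op f p)" for c p
    by (simp add: fps_op_eq_sum[where N = "degree p"] degree_smult_le
        higher_pderiv_smult smult_sum_right mult.commute)
  ultimately show ?thesis by (simp add: linear_op_iff)
qed

lemma fps_op_smult: "fps_op f (smult c p) = smult c (fps_op f p)"
  by (rule linear_op_smult[OF linear_fps_op])

lemma fps_op_0_right [simp]: "fps_op f 0 = 0"
  by (simp add: fps_op_def)

lemma fps_op_add: "fps_op (f + g) p = fps_op f p + fps_op g p"
  by (simp add: fps_op_def smult_add_left sum.distrib)

lemma fps_op_diff: "fps_op (f - g) p = fps_op f p - fps_op g p"
  by (simp add: fps_op_def smult_diff_left sum_subtractf)

lemma fps_op_const_mult: "fps_op (fps_const c * f) p = smult c (fps_op f p)"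
  by (simp add: fps_op_def smult_sum_right)

lemma fps_op_sum: "fps_op (\<Sum>i\<in>A. f i) p = (\<Sum>i\<in>A. fps_op (f i) p)"
  by (induction A rule: infinite_finite_induct) (simp_all add: fps_op_add, simp_all add: fps_op_def)

lemma fps_op_1 [simp]: "fps_op 1 p = p"
proof -
  have "fps_op 1 p = (\<Sum>k\<le>degree p. if k = 0 then p else 0)"
    unfolding fps_op_def by (intro sum.cong) auto
  then show ?thesis by simp
qed

lemma fps_op_X: "fps_op fps_X p = pderiv p"
proof -
  have "fps_op fps_X p = (\<Sum>k\<le>Suc (degree p). if k = 1 then pderiv p else 0)"
    unfolding fps_op_eq_sum[of p "Suc (degree p)", OF le_SucI[OF order_refl]]
    by (intro sum.cong) auto
  then show ?thesis by simp
qed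

lemma degree_fps_op_le: "degree (fps_op f p) \<le> degree p"
  unfolding fps_op_def
  by (intro degree_sum_le) (auto intro!: order.trans[OF degree_smult_le] simp: degree_higher_pderiv)

text \<open>Cauchy product: on the square of index pairs, terms with \<open>i + j > N\<close> vanish
  because the order of the derivative exceeds \<open>degree p\<close>; the remaining triangle is
  regrouped by \<open>n = i + j\<close>.\<close>

lemma fps_op_mult: "fps_op (f * g) p = fps_op f (fps_op g p)"
proof -
  define N where "N = degree p"
  let ?t = "\<lambda>i j. smult (fps_nth f i * fps_nth g j) ((pderiv ^^ (i + j)) p)"
  have "fps_op f (fps_op g p) = (\<Sum>i\<le>N. \<Sum>j\<le>N. ?t i j)"
    unfolding N_def fps_op_eq_sum[OF degree_fps_op_le[of g p]]
    by (simp add: fps_op_def[of g] higher_pderiv_sum higher_pderiv_smult smult_sum_right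
        funpow_add)
  also have "\<dots> = (\<Sum>(i, j)\<in>{..N} \<times> {..N}. ?t i j)"
    by (simp add: sum.cartesian_product)
  also have "\<dots> = (\<Sum>(i, j)\<in>{(i, j). i + j \<le> N}. ?t i j)"
    by (intro sum.mono_neutral_right) (auto simp: N_def intro!: leI dest: higher_pderiv_eq_0)
  also have "\<dots> = (\<Sum>n\<le>N. \<Sum>i\<le>n. ?t i (n - i))"
    by (rule sum.triangle_reindex_eq)
  also have "\<dots> = fps_op (f * g) p"
    by (auto simp: fps_op_def N_def fps_mult_nth smult_sum atLeast0AtMost intro!: sum.cong)
  finally show ?thesis ..
qed

lemma fps_op_power: "(fps_op f ^^ m) p = fps_op (f ^ m) p"
  by (induction m) (simp_all add: fps_op_mult)

lemma coeff_fps_op_degree: "coeff (fps_op f p) (degree p) = fps_nth f 0 * lead_coeff p"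
proof -
  have "coeff (fps_op f p) (degree p) =
      (\<Sum>k\<le>degree p. if k = 0 then fps_nth f 0 * lead_coeff p else 0)"
    unfolding fps_op_def coeff_sum
    by (intro sum.cong) (auto simp: coeff_higher_pderiv coeff_eq_0)
  then show ?thesis by simp
qed

lemma degree_fps_op:
  assumes "fps_nth f 0 \<noteq> 0"
  shows "degree (fps_op f p) = degree p"
proof (cases "p = 0")
  case False
  then have "coeff (fps_op f p) (degree p) \<noteq> 0"
    using assms by (simp add: coeff_fps_op_degree)
  then show ?thesis
    using degree_fps_op_le le_degree by (metis order_antisym)
qed simp

section \<open>Pincherle derivative of a power series in \<open>D\<close>\<close>

lemma higher_pderiv_xhat:
  "(pderiv ^^ k) (xhat p) = xhat ((pderiv ^^ k) p) + smult (of_nat k) ((pderiv ^^ (k - 1)) p)"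
proof (induction k)
  case (Suc k)
  have "pderiv (xhat q) = q + xhat (pderiv q)" for q :: "'a poly"
    by (simp add: xhat_def pderiv_pCons)
  with Suc show ?case
    by (cases k) (simp_all add: pderiv_add pderiv_smult smult_add_left algebra_simps)
qed simp

lemma pincherle_fps_op: "pincherle (fps_op f) p = fps_op (fps_deriv f) p"
proof -
  let ?N = "degree p"
  \<comment> \<open>Multiplication by \<open>x\<close> can raise the degree, so one extra term is
    needed.\<close>
  have deg: "degree (xhat p) \<le> Suc ?N"
    unfolding xhat_def by (simp add: degree_pCons_le)
  have xsum: "xhat (\<Sum>i\<in>A. h i) = (\<Sum>i\<in>A. xhat (h i))" for A and h :: "nat \<Rightarrow> 'a poly"
    unfolding xhat_def by (rule sum_distrib_left)
  have "fps_op f (xhat p) = (\<Sum>k\<le>Suc ?N. smult (fps_nth f k) (xhat ((pderiv ^^ k) p)))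
      + (\<Sum>k\<le>Suc ?N. smult (fps_nth f k * of_nat k) ((pderiv ^^ (k - 1)) p))"
    unfolding fps_op_eq_sum[OF deg] higher_pderiv_xhat
    by (simp only: smult_add_right sum.distrib smult_smult)
  also have "(\<Sum>k\<le>Suc ?N. smult (fps_nth f k) (xhat ((pderiv ^^ k) p))) = xhat (fps_op f p)"
    unfolding fps_op_eq_sum[of p "Suc ?N" f, OF le_SucI[OF order_refl]] xsum
    by (simp add: xhat_def mult_smult_right)
  \<comment> \<open>The term \<open>k = 0\<close> has factor zero, so the truncated
    \<open>k - 1\<close> is harmless; shifting the index exposes the coefficients of
    \<open>fps_deriv f\<close>.\<close>
  also have "(\<Sum>k\<le>Suc ?N. smult (fps_nth f k * of_nat k) ((pderiv ^^ (k - 1)) p)) =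
      fps_op (fps_deriv f) p"
    unfolding fps_op_def by (subst sum.atMost_Suc_shift) (simp add: mult.commute)
  finally show ?thesis by (simp add: pincherle_def)
qed

subsection \<open>Shift-invariant operators\<close>

text \<open>By the chain rule \<open>pderiv\<close> commutes with shifts, and shifts preserve the
  degree, hence also the range of the sum.\<close>

lemma shift_invariant_fps_op: "shift_invariant (fps_op f)"
proof -
  have D: "(pderiv ^^ k) (shift a p) = shift a ((pderiv ^^ k) p)" for k a and p :: "'a poly"
    by (induction k) (simp_all add: shift_def pderiv_pcompose pderiv_pCons)
  have "degree (shift a p) = degree p" for a and p :: "'a poly"
    by (simp add: shift_def degree_pcompose)
  then have "fps_op f (shift a p) = shift a (fps_op f p)" for a p
    unfolding fps_op_def D by (simp add: shift_def pcompose_sum pcompose_smult)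
  then show ?thesis
    by (simp add: shift_invariant_def linear_fps_op fun_eq_iff)
qed

lemma higher_pderiv_monom_one:
  assumes "k \<le> n"
  shows "(pderiv ^^ k) (monom (1::'a::field_char_0) n) = monom (fact n / fact (n - k)) (n - k)"
  using assms
proof (induction k)
  case (Suc k)
  then have "n - k = Suc (n - Suc k)" by simp
  moreover have "(pderiv ^^ k) (monom (1::'a) n) = monom (fact n / fact (n - k)) (n - k)"
    using Suc by simp
  ultimately show ?case
    by (simp add: pderiv_monom field_simps del: of_nat_Suc)
qed simp

text \<open>Evaluating \<open>T x\<^sup>n\<close> at \<open>a\<close> is evaluating \<open>T (x + a)\<^sup>n\<close> at \<open>0\<close>, so \<open>T\<close> is determined by the
  values \<open>(T x\<^sup>k)(0)\<close>.\<close>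

lemma shift_invariant_imp_fps_op:
  fixes T :: "'a::field_char_0 poly \<Rightarrow> 'a poly"
  assumes "shift_invariant T"
  shows "\<exists>f. T = fps_op f"
proof -
  from assms have lin: "linear_op T" and sh: "\<And>a p. T (shift a p) = shift a (T p)"
    by (auto simp: shift_invariant_def fun_eq_iff)
  \<comment> \<open>The value of \<open>f(D) x^k\<close> at \<open>0\<close> is
    \<open>fact k\<close> times the \<open>k\<close>-th coefficient of \<open>f\<close>, which
    forces this choice.\<close>
  define f where "f = Abs_fps (\<lambda>k. poly (T (monom 1 k)) 0 / fact k)"
  have "poly (T (monom 1 n)) a = poly (fps_op f (monom 1 n)) a" for n a
  proof -
    have "shift a (monom 1 n) = ([:a, 1:] :: 'a poly) ^ n"
      by (simp add: poly_eq_poly_eq_iff[symmetric] fun_eq_iff shift_def poly_pcompose poly_monom)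
    also have "\<dots> = (monom 1 1 + [:a:]) ^ n"
      by (simp add: monom_altdef)
    also have "\<dots> = (\<Sum>k\<le>n. smult (of_nat (n choose k) * a ^ (n - k)) (monom 1 k))"
      by (simp add: binomial_ring monom_power poly_const_pow of_nat_poly mult.commute)
    finally have "poly (T (shift a (monom 1 n))) 0 =
        (\<Sum>k\<le>n. of_nat (n choose k) * a ^ (n - k) * poly (T (monom 1 k)) 0)"
      by (simp add: linear_op_sum[OF lin] linear_op_smult[OF lin] poly_sum)
    moreover have "poly (T (shift a (monom 1 n))) 0 = poly (T (monom 1 n)) a"
      unfolding sh by (simp add: shift_def poly_pcompose)
    moreover have "poly (fps_op f (monom 1 n)) a =
        (\<Sum>k\<le>n. of_nat (n choose k) * a ^ (n - k) * poly (T (monom 1 k)) 0)"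
      by (auto simp: fps_op_def degree_monom_eq poly_sum higher_pderiv_monom_one poly_monom
          f_def binomial_fact field_simps intro!: sum.cong)
    ultimately show ?thesis by simp
  qed
  then have "T (monom 1 n) = fps_op f (monom 1 n)" for n
    by (simp add: poly_eq_poly_eq_iff[symmetric] fun_eq_iff)
  then have "T = fps_op f"
    by (intro linear_op_eqI lin linear_fps_op)
  then show ?thesis ..
qed

section \<open>Delta operators and the quotient \<open>D/Q\<close>\<close>

lemma delta_operator_fps_op:
  fixes Q :: "'a::field_char_0 poly \<Rightarrow> 'a poly"
  assumes "delta_operator Q"
  obtains p where "Q = fps_op (fps_X * p)" "fps_nth p 0 \<noteq> 0"
proof -
  from assms obtain f c where f: "Q = fps_op f" and c: "c \<noteq> 0" "Q [:0, 1:] = [:c:]"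
    by (auto simp: delta_operator_def dest!: shift_invariant_imp_fps_op)
  \<comment> \<open>Only the orders 0 and 1 act on \<open>x\<close>; the constant value makes the
    coefficient of order 0 vanish, so \<open>fps_X\<close> divides \<open>f\<close>.\<close>
  have "[:c:] = [:fps_nth f 1, fps_nth f 0:]"
    using c(2) by (simp add: f fps_op_def pderiv_pCons)
  with c(1) have "fps_nth f 0 = 0" "fps_nth f 1 \<noteq> 0" by auto
  then have "f = fps_X * fps_shift 1 f" "fps_nth (fps_shift 1 f) 0 \<noteq> 0"
    by (auto simp: fps_eq_iff)
  then show thesis using that f by metis
qed

text \<open>Termwise integration, possible in characteristic zero. It serves to cancel
  \<open>pderiv\<close> when \<open>P\<close> is shown to be unique.\<close>

lemma pderiv_surj:
  fixes p :: "'a::field_char_0 poly"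
  obtains q where "p = pderiv q"
proof -
  define q where "q = (\<Sum>n\<le>degree p. monom (coeff p n / of_nat (Suc n)) (Suc n))"
  have "pderiv q = (\<Sum>n\<le>degree p. monom (coeff p n) n)"
    by (simp add: q_def pderiv_monom higher_pderiv_sum[of 1, simplified] del: of_nat_Suc)
  then have "p = pderiv q" by (simp add: poly_as_sum_of_monoms)
  then show thesis by (rule that)
qed

lemma fps_op_inverse:
  assumes "fps_nth p 0 \<noteq> 0"
  shows "fps_op (inverse p) (fps_op p q) = q" "fps_op p (fps_op (inverse p) q) = q"
  using assms by (simp_all flip: fps_op_mult add: inverse_mult_eq_1 inverse_mult_eq_1')

lemma D_over_fps_op:
  fixes p :: "'a::field_char_0 fps"
  assumes "fps_nth p 0 \<noteq> 0"
  shows "D_over (fps_op (fps_X * p)) = fps_op (inverse p)"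
proof -
  have bij: "bij (fps_op p)"
    using fps_op_inverse[OF assms] by (intro o_bij[of "fps_op (inverse p)"]) auto
  have "(THE P. shift_invariant P \<and> bij P \<and> fps_op (fps_X * p) = pderiv \<circ> P) = fps_op p"
  proof (rule the_equality)
    fix P :: "'a poly \<Rightarrow> 'a poly"
    assume P: "shift_invariant P \<and> bij P \<and> fps_op (fps_X * p) = pderiv \<circ> P"
    then obtain g where g: "P = fps_op g"
      using shift_invariant_imp_fps_op by blast
    have "fps_op g q = fps_op p q" for q
    proof -
      obtain r where r: "q = pderiv r" by (rule pderiv_surj)
      \<comment> \<open>Series commute, so \<open>pderiv\<close> can be applied first, turning
        \<open>r\<close> into the arbitrary polynomial \<open>q\<close>.\<close>
      have "fps_op (g * fps_X) r = fps_op (p * fps_X) r"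
        using P by (simp add: g fun_eq_iff fps_op_mult fps_op_X mult.commute[of _ fps_X])
      then show ?thesis by (simp add: r fps_op_mult fps_op_X)
    qed
    then show "P = fps_op p" by (simp add: g fun_eq_iff)
  qed (use bij in \<open>simp add: shift_invariant_fps_op fun_eq_iff fps_op_mult fps_op_X\<close>)
  then have "D_over (fps_op (fps_X * p)) = inv (fps_op p)"
    by (simp add: D_over_def)
  also have "\<dots> = fps_op (inverse p)"
    by (rule inv_equality) (simp_all add: fps_op_inverse[OF assms])
  finally show ?thesis .
qed

subsection \<open>The operator power\<close>

lemma linear_op_binom_xD_plus_1: "linear_op (op_binom xD_plus_1 m)"
  by (auto simp: linear_op_iff op_binom_def poly_eq_iff coeff_op_ffact_xD_plus_1 algebra_simps)

lemma linear_op_power: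
  assumes "linear_op U"
  shows "linear_op (op_power U xD_plus_1)"
proof -
  let ?t = "\<lambda>m p. ((\<lambda>q. U q - q) ^^ m) (op_binom xD_plus_1 m p)"
  have W: "linear_op (\<lambda>q. U q - q)"
    using assms by (simp add: linear_op_iff smult_diff_right)
  have Wm: "linear_op ((\<lambda>q. U q - q) ^^ m)" for m
    using W by (induction m) (simp_all add: linear_op_iff)
  have t: "linear_op (?t m)" for m
    using Vector_Spaces.linear_compose[OF linear_op_binom_xD_plus_1 Wm] by (simp add: o_def)
  note fin = finite_op_power_terms[OF assms]
  have "op_power U xD_plus_1 (p + q) = op_power U xD_plus_1 p + op_power U xD_plus_1 q" for p q
    using t unfolding op_power_def Sum_any.distrib[OF fin fin, symmetric]
    by (simp add: linear_op_iff)
  moreover have "op_power U xD_plus_1 (smult c p) = smult c (op_power U xD_plus_1 p)" for c p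
  proof -
    \<comment> \<open>As multiplication by a constant polynomial, scaling falls under the ring
      distributivity of \<open>Sum_any\<close>.\<close>
    have "smult c (op_power U xD_plus_1 p) = [:c:] * op_power U xD_plus_1 p"
      by simp
    also have "\<dots> = Sum_any (\<lambda>m. [:c:] * ?t m p)"
      unfolding op_power_def by (rule Sum_any_right_distrib[OF fin])
    also have "\<dots> = op_power U xD_plus_1 (smult c p)"
      unfolding op_power_def using linear_op_smult[OF t] by simp
    finally show ?thesis ..
  qed
  ultimately show ?thesis by (simp add: linear_op_iff)
qed

text \<open>The monomial is an eigenvector of each \<open>op_binom xD_plus_1 m\<close>, with
  eigenvalue \<open>Suc n choose m\<close>. The sum thus becomes the finite binomial expansion of
  \<open>(1 + (u - 1)) ^ Suc n\<close>.\<close>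

lemma op_power_fps_op_monom:
  "op_power (fps_op u) xD_plus_1 (monom 1 n) = fps_op (u ^ Suc n) (monom 1 n)"
proof -
  let ?t = "\<lambda>m. fps_op (fps_const (of_nat (Suc n choose m)) * (u - 1) ^ m) (monom 1 n)"
  have W: "(\<lambda>q. fps_op u q - q) = fps_op (u - 1)"
    by (simp add: fun_eq_iff fps_op_diff)
  have "((\<lambda>q. fps_op u q - q) ^^ m) (op_binom xD_plus_1 m (monom 1 n)) = ?t m" for m
  proof -
    have "op_binom xD_plus_1 m (monom (1::'a) n) = smult (of_nat (Suc n choose m)) (monom 1 n)"
      unfolding op_binom_xD_plus_1_monom by (simp add: smult_monom)
    then show ?thesis
      by (simp only: W fps_op_power fps_op_smult fps_op_const_mult)
  qed
  then have "op_power (fps_op u) xD_plus_1 (monom 1 n) = Sum_any ?t"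
    by (simp add: op_power_def)
  also have "\<dots> = (\<Sum>m\<le>Suc n. ?t m)"
  proof (rule Sum_any.expand_superset)
    show "{m. ?t m \<noteq> 0} \<subseteq> {..Suc n}"
      by (auto simp: fps_op_const_mult intro!: leI dest: binomial_eq_0)
  qed simp
  also have "\<dots> = fps_op (\<Sum>m\<le>Suc n. fps_const (of_nat (Suc n choose m)) * (u - 1) ^ m) (monom 1 n)"
    by (simp only: fps_op_sum)
  also have "(\<Sum>m\<le>Suc n. fps_const (of_nat (Suc n choose m)) * (u - 1) ^ m) = u ^ Suc n"
    using binomial_ring[of "u - 1" 1 "Suc n"] by (simp add: fps_of_nat del: power_Suc)
  finally show ?thesis .
qed

subsection \<open>The basic sequence\<close>

lemma pderiv_fps_op: "pderiv (fps_op f p) = fps_op f (pderiv p)"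
  by (simp flip: fps_op_X fps_op_mult add: mult.commute)

text \<open>Uniqueness by induction: cancelling the invertible \<open>p(D)\<close> shows that two
  candidates differ by a constant, which vanishes because both are zero at \<open>0\<close>.\<close>

lemma basic_sequence_eqI:
  fixes p :: "'a::field_char_0 fps"
  assumes p: "fps_nth p 0 \<noteq> 0" and s: "is_basic_sequence (fps_op (fps_X * p)) s"
  shows "basic_sequence (fps_op (fps_X * p)) = s"
  unfolding basic_sequence_def
proof (rule the_equality)
  fix r assume r: "is_basic_sequence (fps_op (fps_X * p)) r"
  have "r n = s n" for n
  proof (induction n)
    case 0
    show ?case using r s by (simp add: is_basic_sequence_def)
  next
    case (Suc n)
    have "fps_op (fps_X * p) (r (Suc n)) = fps_op (fps_X * p) (s (Suc n))"
      using r s Suc by (simp add: is_basic_sequence_def)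
    then have "fps_op p (pderiv (r (Suc n))) = fps_op p (pderiv (s (Suc n)))"
      by (simp add: fps_op_mult fps_op_X pderiv_fps_op)
    then have "pderiv (r (Suc n)) = pderiv (s (Suc n))"
      by (metis fps_op_inverse(1) p)
    then have "pderiv (r (Suc n) - s (Suc n)) = 0"
      by (simp add: pderiv_diff)
    then obtain c where "r (Suc n) - s (Suc n) = [:c:]"
      by (metis degree_eq_zeroE pderiv_eq_0_iff)
    moreover have "poly (r (Suc n) - s (Suc n)) 0 = 0"
      using r s by (simp add: is_basic_sequence_def)
    ultimately show ?case by simp
  qed
  then show "r = s" ..
qed (fact s)

text \<open>With \<open>v = ?u ^ Suc n\<close>, both sides equal
  \<open>v(D) x^(n+1) - v'(D) x^n\<close>: the left by the product rule for \<open>fps_X * p\<close>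
  and \<open>?u' = - p' * ?u^2\<close>, the right by the Pincherle derivative of
  \<open>v(D)\<close>.\<close>

lemma transfer_formulas_agree:
  fixes p :: "'a::field_char_0 fps"
  assumes "fps_nth p 0 \<noteq> 0"
  shows "fps_op (fps_deriv (fps_X * p) * inverse p ^ Suc (Suc n)) (monom 1 (Suc n)) =
    xhat (fps_op (inverse p ^ Suc n) (monom 1 n))"
proof -
  let ?u = "inverse p"
  have up: "p * ?u = 1"
    using assms by (simp add: inverse_mult_eq_1')
  have "fps_deriv (?u ^ Suc n) = of_nat (Suc n) * fps_deriv ?u * ?u ^ n"
    by (simp only: fps_deriv_power' diff_Suc_1)
  also have "\<dots> = fps_const (- of_nat (Suc n)) * (fps_deriv p * ?u ^ Suc (Suc n))"
    using assms
    by (simp add: fps_inverse_deriv power2_eq_square mult_ac fps_of_nat[symmetric]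
        fps_const_neg[symmetric] del: fps_const_neg of_nat_Suc)
  finally have du: "fps_op (fps_deriv (?u ^ Suc n)) (monom 1 n) =
      - smult (of_nat (Suc n)) (fps_op (fps_deriv p * ?u ^ Suc (Suc n)) (monom 1 n))"
    by (simp only: fps_op_const_mult smult_minus_left)
  \<comment> \<open>This factor \<open>Suc n\<close> matches the one that the power rule produces in
    \<open>du\<close>.\<close>
  have D: "pderiv (monom (1::'a) (Suc n)) = smult (of_nat (Suc n)) (monom 1 n)"
    by (simp add: pderiv_monom smult_monom)
  have "fps_deriv (fps_X * p) * ?u ^ Suc (Suc n) =
      (p * ?u) * ?u ^ Suc n + (fps_deriv p * ?u ^ Suc (Suc n)) * fps_X"
    by (simp add: algebra_simps)
  then have "fps_op (fps_deriv (fps_X * p) * ?u ^ Suc (Suc n)) (monom 1 (Suc n)) =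
      fps_op (?u ^ Suc n) (monom 1 (Suc n)) - fps_op (fps_deriv (?u ^ Suc n)) (monom 1 n)"
    unfolding up du
    by (simp only: fps_op_add fps_op_mult[of _ fps_X] fps_op_X D fps_op_smult mult_1_left
        diff_minus_eq_add)
  also have "\<dots> = xhat (fps_op (?u ^ Suc n) (monom 1 n))"
    unfolding pincherle_fps_op[symmetric] pincherle_def by (simp add: xhat_def monom_Suc)
  finally show ?thesis .
qed

text \<open>The form with \<open>fps_deriv q\<close> yields the recursion under
  \<open>fps_op q\<close>; the form with \<open>xhat\<close> yields the degree and the zero at
  \<open>0\<close>.\<close>

lemma is_basic_sequence_transfer:
  fixes p :: "'a::field_char_0 fps"
  assumes p: "fps_nth p 0 \<noteq> 0"
  defines "q \<equiv> fps_X * p"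
  shows "is_basic_sequence (fps_op q)
    (\<lambda>n. fps_op (fps_deriv q * inverse p ^ Suc n) (monom 1 n))"
    (is "is_basic_sequence _ ?s")
proof -
  have up: "p * inverse p = 1"
    using p by (simp add: inverse_mult_eq_1')
  have u0: "fps_nth (inverse p ^ m) 0 \<noteq> 0" for m
    using p by (simp add: fps_nth_power_0)
  have Suc: "?s (Suc n) = xhat (fps_op (inverse p ^ Suc n) (monom 1 n))" for n
    unfolding q_def by (rule transfer_formulas_agree[OF p])
  \<comment> \<open>On the constant 1 only the constant term of the series acts, and it is
    \<open>p(0) / p(0)\<close>.\<close>
  have "?s 0 = 1"
    using p by (simp add: fps_op_def q_def one_pCons)
  moreover have "degree (?s n) = n" for n
  proof (cases n)
    case (Suc m)
    \<comment> \<open>Multiplication by \<open>x\<close> raises the degree of nonzero polynomials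
      only.\<close>
    have "fps_op (inverse p ^ Suc m) (monom 1 m) \<noteq> 0"
      using coeff_fps_op_degree[of "inverse p ^ Suc m" "monom 1 m"] u0[of "Suc m"]
      by (metis coeff_0 degree_monom_eq lead_coeff_monom mult_1_right one_neq_zero)
    then show ?thesis
      using degree_fps_op[OF u0, of "Suc m" "monom 1 m"] \<open>\<And>n. ?s (Suc n) = _\<close>[of m] Suc
      by (simp add: xhat_def degree_monom_eq del: power_Suc)
  qed (use \<open>?s 0 = 1\<close> in simp)
  moreover have "poly (?s n) 0 = 0" if "n \<ge> 1" for n
    using that Suc[of "n - 1"] by (simp add: xhat_def)
  moreover have "fps_op q (?s n) = smult (of_nat n) (?s (n - 1))" if "n \<ge> 1" for n
  proof -
    from that obtain m where n: "n = Suc m" by (cases n) auto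
    \<comment> \<open>The \<open>p\<close> in \<open>q\<close> cancels one inverse factor, and the
      remaining \<open>fps_X\<close> lowers \<open>x^n\<close> to \<open>n x^m\<close>.\<close>
    have "q * (fps_deriv q * inverse p ^ Suc n) =
        (p * inverse p) * (fps_deriv q * inverse p ^ Suc m) * fps_X"
      by (simp add: q_def n algebra_simps)
    also have "\<dots> = (fps_deriv q * inverse p ^ Suc m) * fps_X"
      by (simp add: up)
    finally have "fps_op q (?s n) = fps_op (fps_deriv q * inverse p ^ Suc m) (pderiv (monom 1 n))"
      by (simp only: fps_op_mult[symmetric] fps_op_X[symmetric])
    also have "pderiv (monom (1::'a) n) = smult (of_nat n) (monom 1 m)"
      by (simp add: pderiv_monom smult_monom n)
    finally show ?thesis by (simp only: fps_op_smult n diff_Suc_1)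
  qed
  ultimately show ?thesis unfolding is_basic_sequence_def by blast
qed

lemma umbral_operator_eqI:
  assumes "linear_op T" "\<And>n. T (monom 1 n) = basic_sequence Q n"
  shows "umbral_operator Q = T"
proof
  fix p
  show "umbral_operator Q p = T p"
    unfolding umbral_operator_def linear_op_expand[OF assms(1), of p] assms(2) ..
qed

theorem mainTheorem8:
  fixes Q :: "'a::field_char_0 poly \<Rightarrow> 'a poly"
  assumes "delta_operator Q"
  shows "umbral_operator Q = pincherle Q \<circ> op_power (D_over Q) xD_plus_1 \<and>
    (\<forall>n\<ge>1. umbral_operator Q (monom 1 n) =
      xhat (op_power (D_over Q) xD_plus_1 (monom 1 (n - 1))))"
proof -
  from assms obtain p where Q: "Q = fps_op (fps_X * p)" and p: "fps_nth p 0 \<noteq> 0"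
    by (rule delta_operator_fps_op)
  define u where "u = inverse p"
  let ?T = "pincherle Q \<circ> op_power (D_over Q) xD_plus_1"
  have D: "D_over Q = fps_op u"
    unfolding Q u_def by (rule D_over_fps_op[OF p])
  have Q': "pincherle Q = fps_op (fps_deriv (fps_X * p))"
    unfolding Q by (intro ext pincherle_fps_op)
  have T: "?T (monom 1 n) = fps_op (fps_deriv (fps_X * p) * u ^ Suc n) (monom 1 n)" for n
    unfolding D Q' by (simp only: o_apply op_power_fps_op_monom fps_op_mult)
  have "linear_op ?T"
    using linear_op_power[OF linear_fps_op, of u] linear_fps_op[of "fps_deriv (fps_X * p)"]
    unfolding D Q' by (simp only: linear_op_iff o_apply simp_thms)
  then have umbral: "umbral_operator Q = ?T"
  proof (rule umbral_operator_eqI)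
    fix n
    show "?T (monom 1 n) = basic_sequence Q n"
      unfolding T unfolding Q basic_sequence_eqI[OF p is_basic_sequence_transfer[OF p]] u_def ..
  qed
  moreover have "umbral_operator Q (monom 1 n) =
      xhat (op_power (D_over Q) xD_plus_1 (monom 1 (n - 1)))" if "n \<ge> 1" for n
  proof -
    from that obtain m where n: "n = Suc m" by (cases n) auto
    show ?thesis
      unfolding umbral T unfolding n u_def transfer_formulas_agree[OF p]
      by (simp only: D op_power_fps_op_monom u_def diff_Suc_1)
  qed
  ultimately show ?thesis by blast
qed

end
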